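(* Let $A$ be a finite set, let $F\colon A^{\mathbb{Z}}\to A^{\mathbb{Z}}$ be a cellular automaton, and let $\mu$ be a Borel probability measure on $A^{\mathbb{Z}}$ that is $F$-invariant and shift ergodic. If $F$ has at least one $\mu$-equicontinuous point, then the set of $F$-periodic points is dense in the topological support $S(\mu)$ of $\mu$, i.e. $S(\mu)\subseteq\overline{\{x\in A^{\mathbb{Z}} : F^p(x)=x \text{ for some integer } p\ge 1\}}$.
   Context: $A^{\mathbb{Z}}$ is the set of bi-infinite sequences $x=(x_i)_{i\in\mathbb{Z}}$ with $x_i\in A$, with the product topology of the discrete topologies on $A$. The shift $\sigma\colon A^{\mathbb{Z}}\to A^{\mathbb{Z}}$ is $\sigma(x)=(x_{i+1})_{i\in\mathbb{Z}}$. A cellular automaton is a continuous map $F\colon A^{\mathbb{Z}}\to A^{\mathbb{Z}}$ commuting with $\sigma$. Here $\mathbb{N}=\{0,1,2,\dots\}$. For integers $i\le j$, $x(i,j)$ denotes the word $x_i\ldots x_j$. For an integer $n\ge 0$ and $x\in A^{\mathbb{Z}}$, let $C_n(x)=\{y\in A^{\mathbb{Z}} : y_j=x_j \text{ for all } -n\le j\le n\}$ and $B_n(x)=\{y\in A^{\mathbb{Z}} : F^i(y)(-n,n)=F^i(x)(-n,n)\text{ for all } i\in\mathbb{N}\}$. A point $x$ is $\mu$-equicontinuous if for all $m\in\mathbb{N}$, $\lim_{n\to\infty}\frac{\mu(C_n(x)\cap B_m(x))}{\mu(C_n(x))}=1$ (in particular $\mu(C_n(x))>0$ for all $n$, so that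 the quotients make sense). $\mu$ is $F$-invariant if $\mu(F^{-1}(E))=\mu(E)$ for every Borel set $E$; $\mu$ is shift ergodic if it is $\sigma$-invariant and ergodic for $\sigma$. The topological support of $\mu$ is $S(\mu)=\overline{\{x\in A^{\mathbb{Z}} : \mu(C_n(x))>0 \text{ for all } n\in\mathbb{N}\}}$. A point $x$ is $F$-periodic if $F^p(x)=x$ for some integer $p\ge 1$. *)

theory Defs
  imports "HOL-Probability.Probability"
begin

text \<open>The alphabet is an arbitrary set \<open>A\<close>; the configuration space over \<open>A\<close> is
  the topological space of all \<open>x :: int \<Rightarrow> 'a\<close> with values in \<open>A\<close>. Maps on configurations
  are total functions of type \<open>(int \<Rightarrow> 'a) \<Rightarrow> (int \<Rightarrow> 'a)\<close> whose values outside that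
  space are irrelevant.\<close>

definition full_shift :: "'a set \<Rightarrow> (int \<Rightarrow> 'a) topology" where
  "full_shift A = product_topology (\<lambda>_. discrete_topology A) UNIV"

abbreviation configs :: "'a set \<Rightarrow> (int \<Rightarrow> 'a) set" where
  "configs A \<equiv> topspace (full_shift A)"

lemma configs_iff: "x \<in> configs A \<longleftrightarrow> (\<forall>i. x i \<in> A)"
  by (auto simp: full_shift_def)

definition shift_map :: "(int \<Rightarrow> 'a) \<Rightarrow> (int \<Rightarrow> 'a)" where
  "shift_map x = (\<lambda>i. x (i + 1))"

definition cellular_automaton :: "'a set \<Rightarrow> ((int \<Rightarrow> 'a) \<Rightarrow> (int \<Rightarrow> 'a)) \<Rightarrow> bool" where
  "cellular_automaton A F \<longleftrightarrow>
     continuous_map (full_shift A) (full_shift A) F \<and>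
     (\<forall>x\<in>configs A. F (shift_map x) = shift_map (F x))"

definition borel_prob_measure :: "'b topology \<Rightarrow> 'b measure \<Rightarrow> bool" where
  "borel_prob_measure X \<mu> \<longleftrightarrow>
     prob_space \<mu> \<and> sets \<mu> = sigma_sets (topspace X) {U. openin X U}"

definition invariant_measure :: "('b \<Rightarrow> 'b) \<Rightarrow> 'b measure \<Rightarrow> bool" where
  "invariant_measure T \<mu> \<longleftrightarrow>
     (\<forall>E\<in>sets \<mu>. measure \<mu> (T -` E \<inter> space \<mu>) = measure \<mu> E)"

text \<open>For probability measures only: strictly invariant sets have measure 0 or 1.\<close>

definition ergodic_measure :: "('b \<Rightarrow> 'b) \<Rightarrow> 'b measure \<Rightarrow> bool" where
  "ergodic_measure T \<mu> \<longleftrightarrow>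
     invariant_measure T \<mu> \<and>
     (\<forall>E\<in>sets \<mu>. T -` E \<inter> space \<mu> = E \<longrightarrow> measure \<mu> E = 0 \<or> measure \<mu> E = 1)"

definition cyl :: "'a set \<Rightarrow> nat \<Rightarrow> (int \<Rightarrow> 'a) \<Rightarrow> (int \<Rightarrow> 'a) set" where
  "cyl A n x = {y \<in> configs A. \<forall>j\<in>{- int n..int n}. y j = x j}"

definition orbit_cyl ::
  "'a set \<Rightarrow> ((int \<Rightarrow> 'a) \<Rightarrow> (int \<Rightarrow> 'a)) \<Rightarrow> nat \<Rightarrow> (int \<Rightarrow> 'a) \<Rightarrow> (int \<Rightarrow> 'a) set" where
  "orbit_cyl A F n x =
     {y \<in> configs A. \<forall>i::nat. \<forall>j\<in>{- int n..int n}. (F ^^ i) y j = (F ^^ i) x j}"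

text \<open>Positivity of the measures of all cylinders around \<open>x\<close> is demanded explicitly,
  since division by zero is total here.\<close>

definition mu_equicontinuous_point ::
  "'a set \<Rightarrow> ((int \<Rightarrow> 'a) \<Rightarrow> (int \<Rightarrow> 'a)) \<Rightarrow> (int \<Rightarrow> 'a) measure \<Rightarrow> (int \<Rightarrow> 'a) \<Rightarrow> bool" where
  "mu_equicontinuous_point A F \<mu> x \<longleftrightarrow>
     x \<in> configs A \<and>
     (\<forall>n. measure \<mu> (cyl A n x) > 0) \<and>
     (\<forall>m. (\<lambda>n. measure \<mu> (cyl A n x \<inter> orbit_cyl A F m x) / measure \<mu> (cyl A n x))
            \<longlonglongrightarrow> 1)"

definition top_support :: "'a set \<Rightarrow> (int \<Rightarrow> 'a) measure \<Rightarrow> (int \<Rightarrow> 'a) set" where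
  "top_support A \<mu> =
     full_shift A closure_of {x \<in> configs A. \<forall>n. measure \<mu> (cyl A n x) > 0}"

definition periodic_points ::
  "'a set \<Rightarrow> ((int \<Rightarrow> 'a) \<Rightarrow> (int \<Rightarrow> 'a)) \<Rightarrow> (int \<Rightarrow> 'a) set" where
  "periodic_points A F = {x \<in> configs A. \<exists>p::nat. p \<ge> 1 \<and> (F ^^ p) x = x}"

end

theory Submission
  imports Defs
begin

text \<open>Let \<open>F\<close> have radius \<open>r\<close> and let \<open>z\<close> be \<open>\<mu>\<close>-equicontinuous, so that
  \<open>B = orbit_cyl A F r z\<close> has positive measure. By shift ergodicity, for every cylinder \<open>U\<close> of
  positive measure there are \<open>a, b\<close> such that the points \<open>y \<in> B\<close> whose translates by \<open>a\<close> and
  \<open>a + b\<close> lie in \<open>U\<close> and \<open>B\<close> form a set of positive measure; by Poincare recurrence one of them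
  returns to its own values on \<open>[0, P)\<close>, \<open>P = a + b\<close>, after \<open>p\<close> steps of \<open>F\<close>. The columns of
  width \<open>2 r + 1\<close> over \<open>0\<close> and \<open>P\<close> carry the same evolution (that of \<open>z\<close>), so the
  \<open>P\<close>-periodic repetition of \<open>y\<close> evolves like \<open>y\<close> between them and is therefore fixed by
  \<open>F ^^ p\<close>; its translate by \<open>a\<close> lies in \<open>U\<close>.\<close>

section \<open>Recurrence\<close>

lemma measurable_funpow:
  assumes "T \<in> measurable M M"
  shows "(T ^^ n) \<in> measurable M M"
proof (induction n)
  case (Suc n)
  then show ?case using measurable_compose[OF Suc assms] by simp
qed (simp add: id_def)

lemma invariant_measure_funpow:
  assumes T: "T \<in> measurable M M" and inv: "invariant_measure T M" and E: "E \<in> sets M"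
  shows "measure M ((T ^^ n) -` E \<inter> space M) = measure M E"
proof (induction n)
  case 0
  then show ?case using sets.sets_into_space[OF E] by (simp add: Int_absorb2)
next
  case (Suc n)
  have "(T ^^ Suc n) -` E \<inter> space M = T -` ((T ^^ n) -` E \<inter> space M) \<inter> space M"
    using measurable_space[OF T] by (auto simp: funpow_swap1)
  moreover have "(T ^^ n) -` E \<inter> space M \<in> sets M"
    using measurable_sets[OF measurable_funpow[OF T] E] .
  ultimately show ?case using inv Suc unfolding invariant_measure_def by metis
qed

text \<open>Pigeonhole: the sets \<open>S n\<close> all have measure \<open>prob E\<close>, so more
  than \<open>1 / prob E\<close> of them cannot be disjoint. A common point of \<open>S a\<close>
  and \<open>S b\<close>, moved forward by \<open>a\<close> steps, lies in \<open>E\<close> and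
  returns to it after \<open>b - a\<close> steps.\<close>

lemma (in prob_space) poincare_recurrence:
  assumes T: "T \<in> measurable M M" and inv: "invariant_measure T M"
    and E: "E \<in> events" and pos: "prob E > 0"
  shows "\<exists>y p. y \<in> E \<and> p \<ge> 1 \<and> (T ^^ p) y \<in> E"
proof -
  define S where "S n = (T ^^ n) -` E \<inter> space M" for n
  have S: "S n \<in> events" for n
    using measurable_sets[OF measurable_funpow[OF T] E] by (simp add: S_def)
  have mS: "prob (S n) = prob E" for n
    using invariant_measure_funpow[OF T inv E] by (simp add: S_def)
  obtain N :: nat where N: "1 < real N * prob E"
    using pos reals_Archimedean3 by blast
  have "\<not> disjoint_family_on S {..<N}"
  proof
    assume "disjoint_family_on S {..<N}"
    then have "prob (\<Union>n\<in>{..<N}. S n) = (\<Sum>n\<in>{..<N}. prob (S n))"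
      using S by (intro finite_measure_finite_Union) auto
    then have "prob (\<Union>n\<in>{..<N}. S n) > 1" using N by (simp add: mS)
    then show False using prob_le_1 by (simp add: not_less[symmetric])
  qed
  then obtain a b x where "a \<noteq> b" "x \<in> S a" "x \<in> S b"
    unfolding disjoint_family_on_def by blast
  then obtain a b where ab: "a < b" "x \<in> S a" "x \<in> S b"
    by (meson linorder_neqE_nat)
  have "(T ^^ (b - a)) ((T ^^ a) x) = (T ^^ b) x"
    using ab(1) by (metis comp_apply funpow_add le_add_diff_inverse2 less_imp_le)
  then show ?thesis
    using ab by (intro exI[of _ "(T ^^ a) x"] exI[of _ "b - a"]) (auto simp: S_def)
qed

text \<open>Almost every point visits \<open>D\<close> infinitely often, so a set of positive
  measure cannot miss \<open>D\<close> at all late times. The bound \<open>J\<close> later keeps the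
  windows under comparison apart.\<close>

lemma (in prob_space) ergodic_hitting:
  assumes T: "T \<in> measurable M M" and erg: "ergodic_measure T M"
    and C: "C \<in> events" and pC: "prob C > 0" and D: "D \<in> events" and pD: "prob D > 0"
  shows "\<exists>j\<ge>J. prob (C \<inter> ((T ^^ j) -` D \<inter> space M)) > 0"
proof (rule ccontr)
  assume neg: "\<not> ?thesis"
  define S where "S n = (T ^^ n) -` D \<inter> space M" for n
  have S: "S n \<in> events" for n
    using measurable_sets[OF measurable_funpow[OF T] D] by (simp add: S_def)
  define G where "G k = (\<Union>j\<in>{k..}. S j)" for k
  have G: "G k \<in> events" for k using S by (auto simp: G_def)
  have pre: "T -` G k \<inter> space M = G (Suc k)" for k
  proof -
    have "x \<in> T -` G k \<inter> space M \<longleftrightarrow> x \<in> space M \<and> (\<exists>j\<ge>k. (T ^^ Suc j) x \<in> D)" for x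
      using measurable_space[OF T] by (auto simp: G_def S_def funpow_swap1)
    moreover have "x \<in> G (Suc k) \<longleftrightarrow> x \<in> space M \<and> (\<exists>j\<ge>k. (T ^^ Suc j) x \<in> D)" for x
    proof -
      have "(\<exists>i\<ge>Suc k. (T ^^ i) x \<in> D) \<longleftrightarrow> (\<exists>j\<ge>k. (T ^^ Suc j) x \<in> D)"
        by (metis Suc_le_D Suc_le_mono)
      then show ?thesis by (auto simp: G_def S_def simp del: funpow.simps)
    qed
    ultimately show ?thesis by blast
  qed
  have inv: "invariant_measure T M" using erg by (simp add: ergodic_measure_def)
  \<comment> \<open>By \<open>pre\<close> and invariance the decreasing sets \<open>G k\<close> have
    constant measure, so no mass is lost in passing to their intersection \<open>H\<close>.\<close>
  have mG: "prob (G k) = prob (G 0)" for k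
  proof (induction k)
    case (Suc k)
    then show ?case using inv G[of k] pre[of k] unfolding invariant_measure_def by metis
  qed simp
  define H where "H = (\<Inter>k. G k)"
  have H: "H \<in> events" using G by (auto simp: H_def)
  have dec: "decseq G" unfolding decseq_def G_def by (intro allI impI UN_mono) auto
  have "(\<lambda>k. prob (G k)) \<longlonglongrightarrow> prob H"
    unfolding H_def using G dec by (intro finite_Lim_measure_decseq) auto
  then have mH: "prob H = prob (G 0)" by (subst (asm) mG) (simp add: LIMSEQ_const_iff)
  have "S 0 = D" using sets.sets_into_space[OF D] by (auto simp: S_def)
  then have "D \<subseteq> G 0" by (auto simp: G_def)
  then have "prob H > 0"
    using pD finite_measure_mono[OF _ G, of D 0] mH by simp
  \<comment> \<open>Taking preimages only moves \<open>G k\<close> to \<open>G (Suc k)\<close>. The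
    intersection absorbs this index shift and is strictly invariant, as
    \<open>ergodic_measure\<close> demands.\<close>
  moreover have "T -` H \<inter> space M = H"
  proof -
    have "T -` H \<inter> space M = (\<Inter>k. T -` G k \<inter> space M)" by (auto simp: H_def)
    also have "\<dots> = (\<Inter>k. G (Suc k))" by (simp only: pre)
    also have "\<dots> = H" using decseqD[OF dec, OF le_SucI[OF order_refl]] by (fastforce simp: H_def)
    finally show ?thesis .
  qed
  ultimately have "prob H = 1" using erg H by (force simp: ergodic_measure_def)
  then have aeH: "AE x in M. x \<in> H" using H by (simp add: prob_eq_1)
  have "AE x in M. j \<ge> J \<longrightarrow> x \<notin> C \<inter> S j" for j
  proof (cases "j \<ge> J")
    case True
    then have "prob (C \<inter> S j) = 0" using neg measure_nonneg by (force simp: S_def not_less antisym)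
    then show ?thesis using C S by (subst (asm) prob_eq_0) auto
  qed simp
  then have "AE x in M. \<forall>j. j \<ge> J \<longrightarrow> x \<notin> C \<inter> S j" by (simp add: AE_all_countable)
  with aeH have "AE x in M. x \<notin> C"
    by eventually_elim (auto simp: H_def G_def)
  then show False using prob_eq_0[OF C] pC by simp
qed

section \<open>The full shift\<close>

lemma cyl_self: "x \<in> configs A \<Longrightarrow> x \<in> cyl A n x"
  by (simp add: cyl_def)

lemma openin_coordinate: "openin (full_shift A) {y \<in> configs A. y j = c}"
proof -
  have "continuous_map (full_shift A) (discrete_topology A) (\<lambda>y. y j)"
    unfolding full_shift_def by (rule continuous_map_product_projection) simp
  moreover have "openin (discrete_topology A) ({c} \<inter> A)" by simp
  ultimately have "openin (full_shift A) {y \<in> configs A. y j \<in> {c} \<inter> A}"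
    by (rule openin_continuous_map_preimage)
  moreover have "{y \<in> configs A. y j \<in> {c} \<inter> A} = {y \<in> configs A. y j = c}"
    by (auto simp: configs_iff)
  ultimately show ?thesis by simp
qed

lemma openin_cyl: "openin (full_shift A) (cyl A n x)"
proof -
  have "cyl A n x = (\<Inter>j\<in>{- int n..int n}. {y \<in> configs A. y j = x j})"
    by (auto simp: cyl_def)
  then show ?thesis by (auto intro: openin_INT2 openin_coordinate)
qed

text \<open>A basic open set of the product constrains finitely many coordinates, and a large enough
  symmetric window contains them all.\<close>

lemma openin_contains_cyl:
  assumes "openin (full_shift A) U" "x \<in> U"
  shows "\<exists>n. cyl A n x \<subseteq> U"
proof -
  obtain V where V: "finite {i. V i \<noteq> A}" "x \<in> PiE UNIV V" "PiE UNIV V \<subseteq> U"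
    using assms unfolding full_shift_def openin_product_topology_alt by fastforce
  obtain n where n: "\<And>i. V i \<noteq> A \<Longrightarrow> \<bar>i\<bar> \<le> int n"
  proof -
    have "finite ((\<lambda>i. nat \<bar>i\<bar>) ` {i. V i \<noteq> A})" using V(1) by simp
    then obtain n where "\<forall>k\<in>(\<lambda>i. nat \<bar>i\<bar>) ` {i. V i \<noteq> A}. k \<le> n"
      using finite_nat_set_iff_bounded_le by blast
    then show ?thesis by (intro that[of n]) fastforce
  qed
  have "cyl A n x \<subseteq> PiE UNIV V"
  proof
    fix y assume y: "y \<in> cyl A n x"
    have "y i \<in> V i" for i
    proof (cases "V i = A")
      case True
      then show ?thesis using y by (auto simp: cyl_def configs_iff)
    next
      case False
      then have "y i = x i" using n[of i] y by (force simp: cyl_def)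
      then show ?thesis using V(2) by auto
    qed
    then show "y \<in> PiE UNIV V" by auto
  qed
  then show ?thesis using V(3) by blast
qed

text \<open>Compactness of the full shift over a finite alphabet. The radius \<open>f x\<close> may
  vary with the centre, which the proof of a uniform radius for \<open>F\<close> exploits.\<close>

lemma finite_cyl_cover:
  assumes "finite A"
  shows "\<exists>K. finite K \<and> K \<subseteq> configs A \<and> configs A \<subseteq> (\<Union>x\<in>K. cyl A (f x) x)"
proof -
  have "compact_space (full_shift A)"
    using assms by (simp add: full_shift_def compact_space_product_topology compact_space_discrete_topology)
  then have fin_sub: "\<exists>\<F>. finite \<F> \<and> \<F> \<subseteq> \<U> \<and> configs A \<subseteq> \<Union>\<F>"
    if "\<forall>U\<in>\<U>. openin (full_shift A) U" "configs A \<subseteq> \<Union>\<U>" for \<U>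
    using that by (simp add: compact_space_alt)
  have "\<exists>\<F>. finite \<F> \<and> \<F> \<subseteq> (\<lambda>x. cyl A (f x) x) ` configs A \<and> configs A \<subseteq> \<Union>\<F>"
  proof (rule fin_sub)
    show "configs A \<subseteq> \<Union>((\<lambda>x. cyl A (f x) x) ` configs A)"
      using cyl_self by fast
  qed (use openin_cyl in blast)
  then obtain \<F> where \<F>: "finite \<F>" "\<F> \<subseteq> (\<lambda>x. cyl A (f x) x) ` configs A" "configs A \<subseteq> \<Union>\<F>"
    by blast
  obtain K where "K \<subseteq> configs A" "finite K" "\<F> = (\<lambda>x. cyl A (f x) x) ` K"
    using finite_subset_image[OF \<F>(1,2)] by blast
  then show ?thesis using \<F>(3) by blast
qed

text \<open>Iterates of \<open>shift_map\<close> move only by natural numbers; transporting a local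
  rule from \<open>0\<close> to an arbitrary cell also requires negative displacements.\<close>

definition translate :: "int \<Rightarrow> (int \<Rightarrow> 'a) \<Rightarrow> (int \<Rightarrow> 'a)" where
  "translate t x = (\<lambda>i. x (i + t))"

lemma translate_configs [simp]: "translate t x \<in> configs A \<longleftrightarrow> x \<in> configs A"
proof -
  have "(\<forall>i. x (i + t) \<in> A) \<longleftrightarrow> (\<forall>i. x i \<in> A)" by (metis diff_add_cancel)
  then show ?thesis by (simp add: configs_iff translate_def)
qed

lemma shift_map_funpow: "shift_map ^^ n = translate (int n)"
  by (induction n) (auto simp: shift_map_def translate_def fun_eq_iff algebra_simps)

lemma continuous_shift_map: "continuous_map (full_shift A) (full_shift A) shift_map"
  unfolding full_shift_def shift_map_def continuous_map_componentwise_UNIV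
  by (auto intro: continuous_map_product_projection)

lemma cellular_automaton_configs:
  assumes "cellular_automaton A F" "x \<in> configs A"
  shows "(F ^^ n) x \<in> configs A"
  using assms by (induction n) (auto simp: cellular_automaton_def continuous_map_def Pi_iff)

lemma cellular_automaton_translate_nat:
  assumes "cellular_automaton A F" "x \<in> configs A"
  shows "F (translate (int n) x) = translate (int n) (F x)"
proof (induction n)
  case 0
  then show ?case by (simp add: translate_def)
next
  case (Suc n)
  have eq: "translate (int (Suc n)) y = shift_map (translate (int n) y)" for y :: "int \<Rightarrow> 'a"
    by (simp add: translate_def shift_map_def fun_eq_iff algebra_simps)
  have "F (shift_map (translate (int n) x)) = shift_map (F (translate (int n) x))"
    using assms by (simp add: cellular_automaton_def)
  then show ?case unfolding eq Suc .
qed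

lemma cellular_automaton_translate:
  assumes "cellular_automaton A F" "x \<in> configs A"
  shows "F (translate t x) = translate t (F x)"
proof (cases "t \<ge> 0")
  case True
  then show ?thesis using cellular_automaton_translate_nat[OF assms, of "nat t"] by simp
next
  case False
  \<comment> \<open>For negative \<open>t\<close> the known case is applied to the inverse
    displacement, starting from \<open>translate t x\<close>, and then undone.\<close>
  have "F (translate (- t) (translate t x)) = translate (- t) (F (translate t x))"
    using cellular_automaton_translate_nat[OF assms(1), of "translate t x" "nat (- t)"] assms False
    by simp
  then have "translate t (F x) = translate t (translate (- t) (F (translate t x)))"
    by (simp add: translate_def)
  then show ?thesis by (simp add: translate_def)
qed

lemma cellular_automaton_funpow_translate:
  assumes "cellular_automaton A F" "x \<in> configs A"
  shows "(F ^^ n) (translate t x) = translate t ((F ^^ n) x)"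
  by (induction n)
    (auto simp: cellular_automaton_translate[OF assms(1)] cellular_automaton_configs assms)

text \<open>The Curtis-Hedlund-Lyndon argument: continuity makes cell \<open>0\<close> of the image
  constant on a cylinder around each point, compactness bounds the radii, and commutation with
  translations carries the bound to every cell.\<close>

lemma cellular_automaton_radius:
  assumes "finite A" and F: "cellular_automaton A F"
  shows "\<exists>r::nat. \<forall>x\<in>configs A. \<forall>y\<in>configs A. \<forall>i.
    (\<forall>j\<in>{i - int r..i + int r}. x j = y j) \<longrightarrow> F x i = F y i"
proof -
  have "\<exists>n. \<forall>y\<in>cyl A n x. F y 0 = F x 0" if x: "x \<in> configs A" for x
  proof -
    have "openin (full_shift A) {y \<in> configs A. F y \<in> {y \<in> configs A. y 0 = F x 0}}"
      using F openin_coordinate unfolding cellular_automaton_def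
      by (intro openin_continuous_map_preimage) auto
    moreover have "F x \<in> configs A" using cellular_automaton_configs[OF F x, of 1] by simp
    ultimately show ?thesis using openin_contains_cyl[of A _ x] x by fastforce
  qed
  then obtain f where f: "\<forall>x\<in>configs A. \<forall>y\<in>cyl A (f x) x. F y 0 = F x 0"
    using bchoice[of "configs A" "\<lambda>x n. \<forall>y\<in>cyl A n x. F y 0 = F x 0"] by blast
  obtain K where K: "finite K" "K \<subseteq> configs A" "configs A \<subseteq> (\<Union>x\<in>K. cyl A (f x) x)"
    using finite_cyl_cover[OF assms(1), of f] by blast
  obtain r where r: "f x \<le> r" if "x \<in> K" for x
    using that[of "Max (f ` K)"] K(1) by simp
  have F0: "F x 0 = F y 0"
    if xy: "x \<in> configs A" "y \<in> configs A" "\<And>j. \<bar>j\<bar> \<le> int r \<Longrightarrow> x j = y j" for x y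
  proof -
    obtain k where k: "k \<in> K" "x \<in> cyl A (f k) k" using K(3) xy(1) by blast
    then have "y \<in> cyl A (f k) k" using xy r[of k] by (fastforce simp: cyl_def)
    then have "F x 0 = F k 0" "F y 0 = F k 0" using f k K(2) by blast+
    then show ?thesis by simp
  qed
  show ?thesis
  proof (intro exI[of _ r] ballI allI impI)
    fix x y i assume xy: "x \<in> configs A" "y \<in> configs A" "\<forall>j\<in>{i - int r..i + int r}. x j = y j"
    have "translate i x j = translate i y j" if "\<bar>j\<bar> \<le> int r" for j
      using xy(3) that by (auto simp: translate_def abs_le_iff)
    then have "F (translate i x) 0 = F (translate i y) 0"
      using xy by (intro F0) auto
    then show "F x i = F y i"
      using xy by (simp add: cellular_automaton_translate[OF F]) (simp add: translate_def)
  qed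
qed

section \<open>Spatially periodic configurations\<close>

text \<open>Agreement on the core \<open>[0, P]\<close> spreads to a collar of width
  \<open>r\<close> on each side: a collar cell moved by one period lands in the core because
  \<open>P \<ge> int r\<close>, and \<open>ends\<close> gives \<open>v\<close> the same repetition
  there, although \<open>v\<close> need not be periodic.\<close>

lemma translate_fixed_agree:
  fixes P :: int
  assumes per: "translate P w = w" and P: "P \<ge> int r"
    and core: "\<And>j. 0 \<le> j \<Longrightarrow> j \<le> P \<Longrightarrow> w j = v j"
    and ends: "\<And>j. \<bar>j\<bar> \<le> int r \<Longrightarrow> v (j + P) = v j"
    and j: "- int r \<le> j" "j \<le> P + int r"
  shows "w j = v j"
proof -
  have per': "w (j + P) = w j" for j using per by (metis translate_def)
  consider "j < 0" | "0 \<le> j" "j \<le> P" | "P < j" by linarith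
  then show ?thesis
  proof cases
    case 1
    then show ?thesis using per'[of j] core[of "j + P"] ends[of j] j P by simp
  next
    case 2
    then show ?thesis by (rule core)
  next
    case 3
    then show ?thesis using per'[of "j - P"] core[of "j - P"] ends[of "j - P"] j P by simp
  qed
qed

lemma translate_fixed_eqI:
  fixes P :: int
  assumes "translate P w = w" "translate P v = v" "P > 0"
    and "\<And>j. 0 \<le> j \<Longrightarrow> j < P \<Longrightarrow> w j = v j"
  shows "w = v"
proof
  fix i
  \<comment> \<open>Only natural multiples of the period are added; for a negative quotient, the
    reduction to \<open>i mod P\<close> therefore starts from \<open>i\<close> instead of from the
    remainder.\<close>
  have *: "u (k + int n * P) = u k" if "translate P u = u" for u :: "int \<Rightarrow> 'a" and k n
  proof (induction n)
    case (Suc n)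
    have "u (k + int n * P + P) = u (k + int n * P)" using that by (metis translate_def)
    then show ?case using Suc by (simp add: algebra_simps)
  qed simp
  have "u i = u (i mod P)" if "translate P u = u" for u :: "int \<Rightarrow> 'a"
  proof (cases "i div P \<ge> 0")
    case True
    then show ?thesis using *[OF that, of "i mod P" "nat (i div P)"] by simp
  next
    case False
    have "u i = u (i + int (nat (- (i div P))) * P)" by (rule *[OF that, symmetric])
    also have "i + int (nat (- (i div P))) * P = i mod P"
      using False by (simp add: minus_div_mult_eq_mod)
    finally show ?thesis .
  qed
  then show "w i = v i" using assms by (metis pos_mod_bound pos_mod_sign)
qed

text \<open>The columns around \<open>0\<close> and \<open>P\<close> act as walls. In each step the
  radius determines the new core from the old core and collars, and the common column evolution then
  restores the collars, so nothing outside them has any influence.\<close>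

lemma periodic_extension_evolution:
  fixes P :: int
  assumes F: "cellular_automaton A F"
    and r: "\<forall>x\<in>configs A. \<forall>y\<in>configs A. \<forall>i.
      (\<forall>j\<in>{i - int r..i + int r}. x j = y j) \<longrightarrow> F x i = F y i"
    and P: "P \<ge> int r" "P > 0"
    and y: "y \<in> orbit_cyl A F r z" and yP: "translate P y \<in> orbit_cyl A F r z"
    and j: "- int r \<le> j" "j \<le> P + int r"
  shows "(F ^^ n) (\<lambda>i. y (i mod P)) j = (F ^^ n) y j"
proof -
  define w where "w = (\<lambda>i. y (i mod P))"
  have yA: "y \<in> configs A" using y by (simp add: orbit_cyl_def)
  then have wA: "w \<in> configs A" by (simp add: w_def configs_iff)
  have wP: "translate P w = w" by (simp add: w_def translate_def)
  have per: "translate P ((F ^^ n) w) = (F ^^ n) w" for n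
    using cellular_automaton_funpow_translate[OF F wA, of n P] wP by simp
  \<comment> \<open>Both columns copy the orbit of \<open>z\<close>, hence each other, at every
    time.\<close>
  have ends: "(F ^^ n) y (j + P) = (F ^^ n) y j" if "\<bar>j\<bar> \<le> int r" for n j
  proof -
    have "(F ^^ n) (translate P y) j = (F ^^ n) y j"
      using y yP that unfolding orbit_cyl_def by (simp add: abs_le_iff)
    then show ?thesis
      by (simp add: cellular_automaton_funpow_translate[OF F yA]) (simp add: translate_def)
  qed
  have "(F ^^ n) w j = (F ^^ n) y j" using j
  proof (induction n arbitrary: j)
    case 0
    \<comment> \<open>At \<open>j = P\<close> the repetition \<open>w\<close> takes the value
      \<open>y 0\<close>, which equals \<open>y P\<close> by \<open>ends\<close> at time
      \<open>0\<close>.\<close>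
    have "w j = y j" if "0 \<le> j" "j \<le> P" for j
      using that ends[of 0 0] P by (cases "j = P") (auto simp: w_def)
    then show ?case
      using 0 translate_fixed_agree[OF wP P(1), of y j] ends[of _ 0] by simp
  next
    case (Suc n)
    have "(F ^^ Suc n) w i = (F ^^ Suc n) y i" if "0 \<le> i" "i \<le> P" for i
    proof -
      have "\<forall>j\<in>{i - int r..i + int r}. (F ^^ n) w j = (F ^^ n) y j"
        using that Suc.IH by auto
      then have "F ((F ^^ n) w) i = F ((F ^^ n) y) i"
        using r cellular_automaton_configs[OF F wA, of n] cellular_automaton_configs[OF F yA, of n]
        by blast
      then show ?thesis by simp
    qed
    then show ?case
      using translate_fixed_agree[OF per P(1), of "Suc n" "(F ^^ Suc n) y" j] ends Suc.prems by blast
  qed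
  then show ?thesis by (simp add: w_def)
qed

section \<open>Borel measures on the full shift\<close>

lemma borel_prob_measure_space:
  assumes "borel_prob_measure X \<mu>"
  shows "space \<mu> = topspace X"
proof -
  have s: "sets \<mu> = sigma_sets (topspace X) {U. openin X U}"
    using assms by (simp add: borel_prob_measure_def)
  have "space \<mu> \<subseteq> topspace X"
    using sigma_sets_into_sp[of "{U. openin X U}" "topspace X" "space \<mu>"] sets.top[of \<mu>] s
      openin_subset by fastforce
  moreover have "topspace X \<in> sets \<mu>" unfolding s by (rule sigma_sets_top)
  ultimately show ?thesis using sets.sets_into_space by blast
qed

lemma borel_prob_measure_open:
  "borel_prob_measure X \<mu> \<Longrightarrow> openin X U \<Longrightarrow> U \<in> sets \<mu>"
  by (auto simp: borel_prob_measure_def)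

lemma borel_prob_measure_measurable:
  assumes \<mu>: "borel_prob_measure X \<mu>" and T: "continuous_map X X T"
  shows "T \<in> measurable \<mu> \<mu>"
proof (rule measurable_sigma_sets)
  show "sets \<mu> = sigma_sets (topspace X) {U. openin X U}"
    using \<mu> by (simp add: borel_prob_measure_def)
  show "{U. openin X U} \<subseteq> Pow (topspace X)" using openin_subset by auto
  show "T \<in> space \<mu> \<rightarrow> topspace X"
    using T by (simp add: borel_prob_measure_space[OF \<mu>] continuous_map_def)
  fix U assume "U \<in> {U. openin X U}"
  then have "openin X {x \<in> topspace X. T x \<in> U}"
    using openin_continuous_map_preimage[OF T] by simp
  then show "T -` U \<inter> space \<mu> \<in> sets \<mu>"
    using borel_prob_measure_open[OF \<mu>] by (simp add: borel_prob_measure_space[OF \<mu>] vimage_def Int_def conj_commute)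
qed

text \<open>A countable intersection, over all times, of preimages of open cylinders.\<close>

lemma orbit_cyl_measurable:
  assumes \<mu>: "borel_prob_measure (full_shift A) \<mu>" and F: "cellular_automaton A F"
  shows "orbit_cyl A F m z \<in> sets \<mu>"
proof -
  have sp: "space \<mu> = configs A" using borel_prob_measure_space[OF \<mu>] .
  have "F \<in> measurable \<mu> \<mu>"
    using borel_prob_measure_measurable[OF \<mu>] F by (simp add: cellular_automaton_def)
  then have "(F ^^ i) -` cyl A m ((F ^^ i) z) \<inter> space \<mu> \<in> sets \<mu>" for i
    using measurable_sets[OF measurable_funpow borel_prob_measure_open[OF \<mu> openin_cyl]] by blast
  then have "(\<Inter>i. (F ^^ i) -` cyl A m ((F ^^ i) z) \<inter> space \<mu>) \<in> sets \<mu>"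
    by (intro sets.countable_INT) auto
  also have "(\<Inter>i. (F ^^ i) -` cyl A m ((F ^^ i) z) \<inter> space \<mu>) = orbit_cyl A F m z"
    using cellular_automaton_configs[OF F] by (auto simp: sp orbit_cyl_def cyl_def)
  finally show ?thesis .
qed

text \<open>Quotients tending to \<open>1\<close> are eventually positive, and a positive numerator
  bounds the measure of the orbit cylinder from below.\<close>

lemma mu_equicontinuous_point_orbit_cyl_pos:
  assumes \<mu>: "borel_prob_measure (full_shift A) \<mu>" and F: "cellular_automaton A F"
    and z: "mu_equicontinuous_point A F \<mu> z"
  shows "measure \<mu> (orbit_cyl A F m z) > 0"
proof -
  interpret prob_space \<mu> using \<mu> by (simp add: borel_prob_measure_def)
  have "(\<lambda>n. prob (cyl A n z \<inter> orbit_cyl A F m z) / prob (cyl A n z)) \<longlonglongrightarrow> 1"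
    using z by (simp add: mu_equicontinuous_point_def)
  then have "\<forall>\<^sub>F n in sequentially. 0 < prob (cyl A n z \<inter> orbit_cyl A F m z) / prob (cyl A n z)"
    by (rule order_tendstoD) simp
  then obtain n where "0 < prob (cyl A n z \<inter> orbit_cyl A F m z) / prob (cyl A n z)"
    using eventually_happens'[OF sequentially_bot] by blast
  then have "0 < prob (cyl A n z \<inter> orbit_cyl A F m z)"
    by (simp add: zero_less_divide_iff measure_nonneg not_less[symmetric])
  also have "\<dots> \<le> prob (orbit_cyl A F m z)"
    using orbit_cyl_measurable[OF \<mu> F] by (intro finite_measure_mono) auto
  finally show ?thesis .
qed

text \<open>Finitely many cylinders of radius \<open>n\<close> cover the space, so they cannot all
  meet \<open>E\<close> in null sets. This fixes a word on a long window before recurrence is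
  applied.\<close>

lemma positive_measure_cyl:
  assumes "finite A" and \<mu>: "borel_prob_measure (full_shift A) \<mu>"
    and E: "E \<in> sets \<mu>" "measure \<mu> E > 0"
  shows "\<exists>w. measure \<mu> (E \<inter> cyl A n w) > 0"
proof (rule ccontr)
  interpret prob_space \<mu> using \<mu> by (simp add: borel_prob_measure_def)
  assume "\<not> ?thesis"
  then have 0: "prob (E \<inter> cyl A n w) = 0" for w
    using measure_nonneg by (force simp: not_less antisym)
  have meas: "E \<inter> cyl A n w \<in> events" for w
    using E borel_prob_measure_open[OF \<mu> openin_cyl] by blast
  obtain K where K: "finite K" "configs A \<subseteq> (\<Union>x\<in>K. cyl A n x)"
    using finite_cyl_cover[OF assms(1), of "\<lambda>_. n"] by blast
  have "E \<subseteq> (\<Union>x\<in>K. E \<inter> cyl A n x)"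
    using K(2) sets.sets_into_space[OF E(1)] borel_prob_measure_space[OF \<mu>] by blast
  then have "prob E \<le> prob (\<Union>x\<in>K. E \<inter> cyl A n x)"
    using K(1) meas by (intro finite_measure_mono sets.finite_UN)
  also have "\<dots> \<le> (\<Sum>x\<in>K. prob (E \<inter> cyl A n x))"
    using K(1) meas by (intro finite_measure_subadditive_finite) auto
  finally show False using E(2) 0 by simp
qed

section \<open>Periodic points in cylinders of positive measure\<close>

lemma periodic_point_in_cyl:
  assumes fin: "finite A" and F: "cellular_automaton A F"
    and \<mu>: "borel_prob_measure (full_shift A) \<mu>"
    and inv: "invariant_measure F \<mu>" and erg: "ergodic_measure shift_map \<mu>"
    and z: "mu_equicontinuous_point A F \<mu> z"
    and x: "measure \<mu> (cyl A k x) > 0"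
  shows "\<exists>w \<in> periodic_points A F. w \<in> cyl A k x"
proof -
  interpret prob_space \<mu> using \<mu> by (simp add: borel_prob_measure_def)
  have sp: "space \<mu> = configs A" using borel_prob_measure_space[OF \<mu>] .
  have Fm: "F \<in> measurable \<mu> \<mu>"
    using borel_prob_measure_measurable[OF \<mu>] F by (simp add: cellular_automaton_def)
  have shift: "shift_map \<in> measurable \<mu> \<mu>"
    using borel_prob_measure_measurable[OF \<mu> continuous_shift_map] .
  have cyl: "cyl A n v \<in> events" for n v
    using borel_prob_measure_open[OF \<mu> openin_cyl] .
  obtain r :: nat where r: "\<forall>x\<in>configs A. \<forall>y\<in>configs A. \<forall>i.
      (\<forall>j\<in>{i - int r..i + int r}. x j = y j) \<longrightarrow> F x i = F y i"
    using cellular_automaton_radius[OF fin F] by blast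
  define B where "B = orbit_cyl A F r z"
  have B: "B \<in> events" "prob B > 0"
    using orbit_cyl_measurable[OF \<mu> F] mu_equicontinuous_point_orbit_cyl_pos[OF \<mu> F z]
    by (auto simp: B_def)
  \<comment> \<open>The lower bound on \<open>b\<close> gives \<open>P \<ge> int r\<close> and
    \<open>P > 0\<close>, and puts the window \<open>[a - k, a + k]\<close> strictly to the left of
    \<open>P\<close>; the bound \<open>a \<ge> k\<close> below keeps it nonnegative.\<close>
  obtain b where b: "b \<ge> k + r + 1" "prob (cyl A k x \<inter> ((shift_map ^^ b) -` B \<inter> space \<mu>)) > 0"
    using ergodic_hitting[OF shift erg cyl x B] by blast
  define C where "C = cyl A k x \<inter> ((shift_map ^^ b) -` B \<inter> space \<mu>)"
  have C: "C \<in> events" "prob C > 0"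
    using b cyl measurable_sets[OF measurable_funpow[OF shift] B(1)] by (auto simp: C_def)
  obtain a where a: "a \<ge> k" "prob (B \<inter> ((shift_map ^^ a) -` C \<inter> space \<mu>)) > 0"
    using ergodic_hitting[OF shift erg B C] by blast
  define D where "D = B \<inter> ((shift_map ^^ a) -` C \<inter> space \<mu>)"
  have D: "D \<in> events" "prob D > 0"
    using a B measurable_sets[OF measurable_funpow[OF shift] C(1)] by (auto simp: D_def)
  define P where "P = int (a + b)"
  have P: "P \<ge> int r" "P > 0" using b by (auto simp: P_def)
  \<comment> \<open>Radius \<open>a + b\<close> covers \<open>[0, P)\<close>, so a return to this
    set reproduces the values of \<open>y\<close> there: both \<open>y\<close> and
    \<open>(F ^^ p) y\<close> agree with \<open>v\<close>.\<close>
  obtain v where v: "prob (D \<inter> cyl A (a + b) v) > 0"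
    using positive_measure_cyl[OF fin \<mu> D] by blast
  obtain y p where yp: "y \<in> D \<inter> cyl A (a + b) v" "p \<ge> 1" "(F ^^ p) y \<in> D \<inter> cyl A (a + b) v"
    using poincare_recurrence[OF Fm inv _ v] D(1) cyl by blast
  have y: "y \<in> B" "translate (int a) y \<in> cyl A k x" "translate P y \<in> B"
    using yp(1) by (auto simp: D_def C_def P_def shift_map_funpow translate_def add_ac)
  have yA: "y \<in> configs A" using yp(1) by (simp add: cyl_def)
  have ret: "(F ^^ p) y j = y j" if "0 \<le> j" "j < P" for j
    using yp that by (simp add: cyl_def P_def)
  define w where "w = (\<lambda>i. y (i mod P))"
  have wA: "w \<in> configs A" using yA by (simp add: w_def configs_iff)
  have wP: "translate P w = w" by (simp add: w_def translate_def)
  have evol: "(F ^^ n) w j = (F ^^ n) y j" if "- int r \<le> j" "j \<le> P + int r" for n j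
    unfolding w_def using periodic_extension_evolution[OF F r P _ _ that] y by (simp add: B_def)
  \<comment> \<open>Both sides have spatial period \<open>P\<close>, so \<open>[0, P)\<close>
    suffices; there \<open>evol\<close> passes from \<open>w\<close> to \<open>y\<close>, where
    \<open>ret\<close> applies.\<close>
  have "(F ^^ p) w = w"
  proof (rule translate_fixed_eqI[OF _ wP P(2)])
    show "translate P ((F ^^ p) w) = (F ^^ p) w"
      using cellular_automaton_funpow_translate[OF F wA, of p P] wP by simp
    show "(F ^^ p) w j = w j" if "0 \<le> j" "j < P" for j
      using evol[of j p] evol[of j 0] ret[OF that] that by simp
  qed
  then have "translate (int a) w \<in> periodic_points A F"
    using wA yp(2) cellular_automaton_funpow_translate[OF F wA, of p "int a"]
    by (auto simp: periodic_points_def)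
  moreover have "w (j + int a) = y (j + int a)" if "\<bar>j\<bar> \<le> int k" for j
    using evol[of "j + int a" 0] that a(1) b(1) by (simp add: P_def)
  then have "translate (int a) w \<in> cyl A k x"
    using y(2) wA by (simp add: cyl_def) (simp add: translate_def abs_le_iff)
  ultimately show ?thesis by blast
qed

theorem proposition2p4:
  fixes A :: "'a set"
    and F :: "(int \<Rightarrow> 'a) \<Rightarrow> (int \<Rightarrow> 'a)"
    and \<mu> :: "(int \<Rightarrow> 'a) measure"
  assumes "finite A"
    and "cellular_automaton A F"
    and "borel_prob_measure (full_shift A) \<mu>"
    and "invariant_measure F \<mu>"
    and "ergodic_measure shift_map \<mu>"
    and "\<exists>x. mu_equicontinuous_point A F \<mu> x"
  shows "top_support A \<mu> \<subseteq> full_shift A closure_of periodic_points A F"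
proof -
  obtain z where z: "mu_equicontinuous_point A F \<mu> z" using assms(6) by blast
  \<comment> \<open>The target is closed, so it is enough to treat the points whose closure defines
    \<open>top_support\<close>.\<close>
  have "x \<in> full_shift A closure_of periodic_points A F"
    if x: "x \<in> configs A" "\<forall>n. measure \<mu> (cyl A n x) > 0" for x
    unfolding in_closure_of
  proof (intro conjI allI impI)
    fix U assume "x \<in> U \<and> openin (full_shift A) U"
    then obtain n where "cyl A n x \<subseteq> U" using openin_contains_cyl by blast
    then show "\<exists>y. y \<in> periodic_points A F \<and> y \<in> U"
      using periodic_point_in_cyl[OF assms(1-5) z] x(2) by blast
  qed (rule x(1))
  then show ?thesis
    unfolding top_support_def by (intro closure_of_minimal) auto
qed

end
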